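(* Let $(\mathfrak{h},\circ,\langle\;,\;\rangle)$ be a $k$-Hessian algebra such that $k<0$ and there exists $u\neq0$ in $\mathfrak{h}$ such that $\mathrm{L}_u=0$. Then there exists $\mathbf{h}=\mu u$, with $\mu\in\mathbb{R}$, such that, for any $X,Y\in\mathfrak{h}$, $$X\circ Y=\langle X,Y\rangle\mathbf{h}-\langle\mathbf{h},Y\rangle X.$$
   Context: All algebras are real and finite-dimensional. For $k\in\mathbb{R}$, a $k$-Hessian algebra is an algebra $(\mathfrak{h},\circ)$ endowed with a scalar product $\langle\;,\;\rangle$ (positive definite) such that for all $X,Y,Z\in\mathfrak{h}$: $\langle X\circ Y-Y\circ X,Z\rangle=\langle Y\circ Z,X\rangle-\langle X\circ Z,Y\rangle$ and $\mathrm{ass}(X,Y,Z)-\mathrm{ass}(Y,X,Z)=k\left(\langle X,Z\rangle Y-\langle Y,Z\rangle X\right)$, where $\mathrm{ass}(X,Y,Z)=(X\circ Y)\circ Z-X\circ(Y\circ Z)$. $\mathrm{L}_u$ is the left multiplication $\mathrm{L}_uY=u\circ Y$. *)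

theory Defs
  imports "HOL-Analysis.Analysis"
begin

text \<open>
  The underlying finite-dimensional real vector space with its positive definite scalar
  product is a type of class \<^class>\<open>euclidean_space\<close>; only the zero space is not
  covered by this class. The product is an arbitrary bilinear map, in general neither
  associative, commutative nor unital.
\<close>

definition associator :: "('a \<Rightarrow> 'a \<Rightarrow> 'a) \<Rightarrow> 'a \<Rightarrow> 'a \<Rightarrow> 'a \<Rightarrow> 'a::euclidean_space" where
  "associator m X Y Z = m (m X Y) Z - m X (m Y Z)"

definition left_mult :: "('a \<Rightarrow> 'a \<Rightarrow> 'a) \<Rightarrow> 'a \<Rightarrow> 'a \<Rightarrow> 'a::euclidean_space" where
  "left_mult m u = (\<lambda>Y. m u Y)"

locale hessian_algebra =
  fixes k :: real
    and m :: "'a::euclidean_space \<Rightarrow> 'a \<Rightarrow> 'a"  (infixl "\<odot>" 70)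
  assumes bilinear_mult: "bilinear (\<odot>)"
    and commutator_inner:
      "(X \<odot> Y - Y \<odot> X) \<bullet> Z = (Y \<odot> Z) \<bullet> X - (X \<odot> Z) \<bullet> Y"
    and associator_diff:
      "associator (\<odot>) X Y Z - associator (\<odot>) Y X Z
         = k *\<^sub>R ((X \<bullet> Z) *\<^sub>R Y - (Y \<bullet> Z) *\<^sub>R X)"

end

theory Submission
  imports Defs
begin

text \<open>
  Everything is controlled by the right multiplication \<open>D X = X \<odot> u\<close>. Since left multiplication
  by \<open>u\<close> vanishes, the commutator identity says that \<open>D\<close> takes values in the hyperplane
  orthogonal to \<open>u\<close>, and the associator identity with \<open>u\<close> in the first slot determines the left
  multiplication by every element of the form \<open>D Y\<close> (lemma \<open>mult_left_range\<close>). Evaluated at \<open>u\<close>,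
  the latter gives \<open>D (D X) = - k |u|\<^sup>2 X\<close> for \<open>X\<close> orthogonal to \<open>u\<close>. As \<open>k \<noteq> 0\<close>, the operator
  \<open>D\<close> is invertible on the hyperplane, so the whole product is known in terms of \<open>D\<close>
  (lemma \<open>mult_eq_right_mult\<close>).

  It remains to see that \<open>D\<close> is a homothety of the hyperplane. Substituting the formula for the
  product into the associator identity of \<open>X\<close>, \<open>D X\<close>, \<open>X\<close>, with \<open>D \<circ> D\<close> known,
  yields two opposite values for the same expression, hence
  \<open>|X|\<^sup>2 D X = (D X \<bullet> X) X\<close>: every vector of the hyperplane is an eigenvector
  (lemma \<open>orthogonal_eigenvector\<close>), and a linear map with this property is a multiple of the
  identity. If the multiple is \<open>s\<close>, the required vector is \<open>h = - (s / |u|\<^sup>2) u\<close>.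
\<close>

text \<open>
  If the eigenvalues of two vectors differ, comparison with the eigenvalue of their sum makes
  the vectors proportional, which forces the eigenvalues to agree after all.
\<close>

lemma linear_all_eigenvectors_imp_scalar:
  fixes f :: "'a::real_vector \<Rightarrow> 'a"
  assumes "linear f" and "subspace S" and eig: "\<And>x. x \<in> S \<Longrightarrow> \<exists>t. f x = t *\<^sub>R x"
  shows "\<exists>s. \<forall>x\<in>S. f x = s *\<^sub>R x"
proof (cases "S \<subseteq> {0}")
  case True
  then have "\<forall>x\<in>S. f x = 0 *\<^sub>R x"
    using linear_0[OF \<open>linear f\<close>] by auto
  then show ?thesis by blast
next
  case False
  then obtain e where e: "e \<in> S" "e \<noteq> 0" by blast
  obtain s where s: "f e = s *\<^sub>R e" using eig[OF e(1)] by blast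
  have "f x = s *\<^sub>R x" if x: "x \<in> S" for x
  proof -
    obtain t where t: "f x = t *\<^sub>R x" using eig[OF x] by blast
    obtain r where r: "f (x + e) = r *\<^sub>R (x + e)"
      using eig subspace_add[OF \<open>subspace S\<close> x e(1)] by blast
    have rel: "(t - r) *\<^sub>R x = (r - s) *\<^sub>R e"
      using r by (simp add: linear_add[OF \<open>linear f\<close>] s t algebra_simps)
    show ?thesis
    proof (cases "r = s")
      case True
      with rel t show ?thesis by auto
    next
      case False
      define c where "c = (t - r) / (r - s)"
      have "e = inverse (r - s) *\<^sub>R ((r - s) *\<^sub>R e)" using False by simp
      also have "\<dots> = c *\<^sub>R x" unfolding rel[symmetric] by (simp add: c_def divide_inverse mult.commute)
      finally have ec: "e = c *\<^sub>R x" .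
      then have "f e = t *\<^sub>R e"
        by (simp add: linear_scale[OF \<open>linear f\<close>] t)
      with s e(2) have "t = s" by simp
      with t show ?thesis by simp
    qed
  qed
  then show ?thesis by blast
qed

context hessian_algebra
begin

lemmas mult_simps =
  bilinear_ladd[OF bilinear_mult] bilinear_radd[OF bilinear_mult]
  bilinear_lmul[OF bilinear_mult] bilinear_rmul[OF bilinear_mult]
  bilinear_lsub[OF bilinear_mult] bilinear_rsub[OF bilinear_mult]
  bilinear_lneg[OF bilinear_mult] bilinear_rneg[OF bilinear_mult]
  bilinear_lzero[OF bilinear_mult] bilinear_rzero[OF bilinear_mult]

lemma linear_right_mult: "linear (\<lambda>X. X \<odot> u)"
  using bilinear_mult by (simp add: bilinear_def)

lemma right_mult_orthogonal:
  assumes "\<And>Y. u \<odot> Y = 0"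
  shows "(X \<odot> u) \<bullet> u = 0"
  using commutator_inner[of u X u] by (simp add: assms)

text \<open>
  With \<open>u\<close> in the first slot, only the term \<open>(Y \<odot> u) \<odot> Z\<close> of the two associators survives.
\<close>

lemma mult_left_range:
  assumes "\<And>Y. u \<odot> Y = 0"
  shows "(Y \<odot> u) \<odot> Z = k *\<^sub>R ((Y \<bullet> Z) *\<^sub>R u - (u \<bullet> Z) *\<^sub>R Y)"
  using associator_diff[of u Y Z]
  by (simp add: associator_def assms mult_simps algebra_simps)

lemma right_mult_twice:
  assumes "\<And>Y. u \<odot> Y = 0" and "X \<bullet> u = 0"
  shows "(X \<odot> u) \<odot> u = (- k * (u \<bullet> u)) *\<^sub>R X"
  by (simp add: mult_left_range[OF assms(1)] assms(2))

text \<open>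
  On the hyperplane orthogonal to \<open>u\<close>, every vector is a multiple of its image under the square
  of right multiplication by \<open>u\<close>, so \<open>mult_left_range\<close> applies to it; both sides vanish at
  \<open>X = u\<close>.
\<close>

lemma mult_eq_right_mult:
  assumes "k \<noteq> 0" and "u \<noteq> 0" and u: "\<And>Y. u \<odot> Y = 0"
  shows "X \<odot> Z = (1 / (u \<bullet> u)) *\<^sub>R ((u \<bullet> Z) *\<^sub>R (X \<odot> u) - ((X \<odot> u) \<bullet> Z) *\<^sub>R u)"
proof -
  define N where "N = u \<bullet> u"
  have N: "N \<noteq> 0" using \<open>u \<noteq> 0\<close> by (simp add: N_def)
  define W where "W = X - ((X \<bullet> u) / N) *\<^sub>R u"
  have W: "W \<bullet> u = 0" using N by (simp add: W_def inner_diff_left N_def)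
  have WX: "W \<odot> Y = X \<odot> Y" for Y by (simp add: W_def mult_simps u)
  have "(- k * N) *\<^sub>R (W \<odot> Z) = ((W \<odot> u) \<odot> u) \<odot> Z"
    by (simp add: right_mult_twice[OF u W] N_def mult_simps)
  also have "\<dots> = k *\<^sub>R (((W \<odot> u) \<bullet> Z) *\<^sub>R u - (u \<bullet> Z) *\<^sub>R (W \<odot> u))"
    by (rule mult_left_range[OF u])
  finally have eq: "(- k * N) *\<^sub>R (X \<odot> Z) = k *\<^sub>R (((X \<odot> u) \<bullet> Z) *\<^sub>R u - (u \<bullet> Z) *\<^sub>R (X \<odot> u))"
    by (simp only: WX)
  have "X \<odot> Z = (- 1 / (k * N)) *\<^sub>R ((- k * N) *\<^sub>R (X \<odot> Z))"
    using \<open>k \<noteq> 0\<close> N by simp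
  also have "\<dots> = (1 / N) *\<^sub>R ((u \<bullet> Z) *\<^sub>R (X \<odot> u) - ((X \<odot> u) \<bullet> Z) *\<^sub>R u)"
    unfolding eq using \<open>k \<noteq> 0\<close> N by (simp add: algebra_simps)
  finally show ?thesis by (simp add: N_def)
qed

text \<open>
  On the hyperplane, products are multiples of \<open>u\<close>, so the associators of \<open>X\<close>, \<open>X \<odot> u\<close>, \<open>X\<close>
  reduce to their second terms. Because the square of right multiplication by \<open>u\<close> is
  \<open>- k |u|\<^sup>2\<close>, the left-hand side of the associator identity comes out as the negative of its
  right-hand side.
\<close>

lemma orthogonal_eigenvector:
  assumes "k \<noteq> 0" and "u \<noteq> 0" and u: "\<And>Y. u \<odot> Y = 0" and X: "X \<bullet> u = 0"
  shows "\<exists>t. X \<odot> u = t *\<^sub>R X"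
proof (cases "X = 0")
  case True
  then show ?thesis by (simp add: mult_simps)
next
  case False
  define N where "N = u \<bullet> u"
  have N: "N \<noteq> 0" using \<open>u \<noteq> 0\<close> by (simp add: N_def)
  define D where "D = X \<odot> u"
  have Du: "D \<bullet> u = 0" unfolding D_def by (rule right_mult_orthogonal[OF u])
  have DD: "D \<odot> u = (- k * N) *\<^sub>R X"
    unfolding D_def N_def by (rule right_mult_twice[OF u X])
  have X_mult: "X \<odot> Z = (- (D \<bullet> Z) / N) *\<^sub>R u" if "Z \<bullet> u = 0" for Z
    using mult_eq_right_mult[OF assms(1,2) u, of X Z] that
    by (simp add: D_def N_def inner_commute)
  have D_mult: "D \<odot> Z = (k * (X \<bullet> Z)) *\<^sub>R u" if "Z \<bullet> u = 0" for Z
    using mult_left_range[OF u, of X Z] that by (simp add: D_def inner_commute)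
  have ass1: "associator (\<odot>) X D X = (- k * (X \<bullet> X)) *\<^sub>R D"
    by (simp add: associator_def X_mult[OF Du] D_mult[OF X] mult_simps u flip: D_def)
  have ass2: "associator (\<odot>) D X X = (- k * (D \<bullet> X)) *\<^sub>R X"
    using N by (simp add: associator_def X_mult[OF X] D_mult[OF X] mult_simps u DD)
  have "(- k * (X \<bullet> X)) *\<^sub>R D - (- k * (D \<bullet> X)) *\<^sub>R X
      = k *\<^sub>R ((X \<bullet> X) *\<^sub>R D - (D \<bullet> X) *\<^sub>R X)"
    using associator_diff[of X D X] by (simp only: ass1 ass2)
  then have "(2 * k) *\<^sub>R ((X \<bullet> X) *\<^sub>R D - (D \<bullet> X) *\<^sub>R X) = 0"
    by (simp add: algebra_simps flip: scaleR_2)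
  then have eq: "(X \<bullet> X) *\<^sub>R D = (D \<bullet> X) *\<^sub>R X" using \<open>k \<noteq> 0\<close> by simp
  have "D = (1 / (X \<bullet> X)) *\<^sub>R ((X \<bullet> X) *\<^sub>R D)" using False by simp
  also have "\<dots> = ((D \<bullet> X) / (X \<bullet> X)) *\<^sub>R X" unfolding eq by simp
  finally show ?thesis unfolding D_def by blast
qed

end

theorem theorem4p1:
  fixes k :: real
    and m :: "'a::euclidean_space \<Rightarrow> 'a \<Rightarrow> 'a"  (infixl "\<odot>" 70)
    and u :: 'a
  assumes "hessian_algebra k (\<odot>)"
    and "k < 0"
    and "u \<noteq> 0"
    and "left_mult (\<odot>) u = (\<lambda>Y. 0)"
  shows "\<exists>h. (\<exists>\<mu>::real. h = \<mu> *\<^sub>R u) \<and>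
    (\<forall>X Y. X \<odot> Y = (X \<bullet> Y) *\<^sub>R h - (h \<bullet> Y) *\<^sub>R X)"
proof -
  interpret hessian_algebra k "(\<odot>)" by fact
  have u: "u \<odot> Y = 0" for Y
    using fun_cong[OF assms(4), of Y] by (simp add: left_mult_def)
  have k: "k \<noteq> 0" using \<open>k < 0\<close> by simp
  define N where "N = u \<bullet> u"
  have N: "N \<noteq> 0" using \<open>u \<noteq> 0\<close> by (simp add: N_def)
  have "subspace {X. X \<bullet> u = 0}"
    by (simp add: subspace_def inner_add_left)
  then obtain s where s: "\<And>X. X \<bullet> u = 0 \<Longrightarrow> X \<odot> u = s *\<^sub>R X"
    using linear_all_eigenvectors_imp_scalar[OF linear_right_mult[of u], of "{X. X \<bullet> u = 0}"]
      orthogonal_eigenvector[OF k \<open>u \<noteq> 0\<close> u] by auto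
  have D: "X \<odot> u = s *\<^sub>R (X - ((X \<bullet> u) / N) *\<^sub>R u)" for X
    using s[of "X - ((X \<bullet> u) / N) *\<^sub>R u"] N
    by (simp add: mult_simps u inner_diff_left N_def)
  define h where "h = (- s / N) *\<^sub>R u"
  have "X \<odot> Y = (X \<bullet> Y) *\<^sub>R h - (h \<bullet> Y) *\<^sub>R X" for X Y
  proof -
    have "X \<odot> Y = (1 / N) *\<^sub>R ((u \<bullet> Y) *\<^sub>R (X \<odot> u) - ((X \<odot> u) \<bullet> Y) *\<^sub>R u)"
      unfolding N_def by (rule mult_eq_right_mult[OF k \<open>u \<noteq> 0\<close> u])
    also have "\<dots> = (X \<bullet> Y) *\<^sub>R h - (h \<bullet> Y) *\<^sub>R X"
      unfolding D h_def
      by (simp add: inner_diff_left scaleR_diff_left scaleR_diff_right right_diff_distrib mult_ac)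
    finally show ?thesis .
  qed
  then show ?thesis unfolding h_def by blast
qed

end
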